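(* In the setting described in the context (a simple eigenvalue $\lambda$ of $H_{r_\lambda}=\hat H_{r_\lambda}\oplus\lambda$ and a regularizing perturbation $V$), let $d$ be an integer not less than two. The order of the real resonance point $r_\lambda$ is equal to $d$ if and only if the vectors $$\hat u_{\lambda+i0}(r_\lambda),\ \hat A_{\lambda+i0}(r_\lambda)\hat u_{\lambda+i0}(r_\lambda),\ \ldots,\ \hat A^{d-3}_{\lambda+i0}(r_\lambda)\hat u_{\lambda+i0}(r_\lambda)$$ are orthogonal to the vector $\hat\psi$ but the vector $\hat A^{d-2}_{\lambda+i0}(r_\lambda)\hat u_{\lambda+i0}(r_\lambda)$ is not (for $d=2$ the list is empty). If this is the case, then for all $j=1,2,\ldots,d$ the vector space $\Upsilon^j_{\lambda+i0}(r_\lambda)$ is $j$-dimensional and is generated by the vectors $$\begin{pmatrix}0\\1\end{pmatrix},\ \begin{pmatrix}\hat u_{\lambda+i0}(r_\lambda)\\0\end{pmatrix},\ \begin{pmatrix}\hat A_{\lambda+i0}(r_\lambda)\hat u_{\lambda+i0}(r_\lambda)\\0\end{pmatrix},\ \ldots,\ \begin{pmatrix}\hat A^{j-2}_{\lambda+i0}(r_\lambda)\hat u_{\lambda+i0}(r_\lambda)\\0\end{pmatrix},$$ which have orders $1,2,\ldots,j$ respectively.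
   Context: Scalar products are linear in the second argument. $\hat{\mathcal H},\hat{\mathcal K}$ are complex separable Hilbert spaces, $\mathcal H=\hat{\mathcal H}\oplus\mathbb C$, $\mathcal K=\hat{\mathcal K}\oplus\mathbb C$. $\hat F:\hat{\mathcal H}\to\hat{\mathcal K}$ is a closed densely defined operator with trivial kernel and co-kernel, and $F=\hat F\oplus1:\mathcal H\to\mathcal K$. $\hat H_{r_\lambda}$ is a self-adjoint operator on $\hat{\mathcal H}$, $\lambda,r_\lambda\in\mathbb R$, and $$H_{r_\lambda}=\begin{pmatrix}\hat H_{r_\lambda}&0\\0&\lambda\end{pmatrix},\qquad J=\begin{pmatrix}\hat J&\hat\psi\\\langle\hat\psi,\cdot\rangle&\alpha\end{pmatrix},\qquad V=F^*JF,$$ where $\hat J$ is a bounded self-adjoint operator on $\hat{\mathcal K}$, $\hat\psi\in\hat{\mathcal K}$, $\alpha\in\mathbb R$; $\lambda$ is an eigenvalue of $H_{r_\lambda}$ of multiplicity one. Put $H_s=H_{r_\lambda}+(s-r_\lambda)V$, $s\in\mathbb R$. Standing assumptions: $V$ is self-adjoint; all $H_s$ are self-adjoint with a common dense domain $\mathcal D\subset\operatorname{dom}(F)\cap\operatorname{dom}(V)$; $V$ is relatively compact with respect to each $H_s$; for non-real $z$ the operators $T_z(H_s):=F(H_s-z)^{-1}F^*$ and $T_z(\hat H_{r_\lambda}):=\hat F(\hat H_{r_\lambda}-z)^{-1}\hat F^*$ (densely defined) extend to compact operators, denoted by the same symbols; and for each $s$ the norm limit $\lim_{y\to0^+}T_{\mu+iy}(H_s)$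 exists for a.e. real $\mu$. It is assumed that $\lambda$ is regular for the pair $(\hat H_{r_\lambda},\hat F)$, that is, the norm limit $T_{\lambda+i0}(\hat H_{r_\lambda}):=\lim_{y\to0^+}T_{\lambda+iy}(\hat H_{r_\lambda})$ exists, and that $V$ is a regularizing direction for $H_{r_\lambda}$ at $\lambda$, that is, for some real $s$ the norm limit $T_{\lambda+i0}(H_s)=\lim_{y\to0^+}T_{\lambda+iy}(H_s)$ exists (such $s$ are called non-resonant). Since $\lambda$ is an eigenvalue of $H_{r_\lambda}$, the point $r_\lambda$ is resonant (the limit does not exist for $s=r_\lambda$). Define $\hat u_{\lambda+i0}(r_\lambda)=T_{\lambda+i0}(\hat H_{r_\lambda})\hat\psi\in\hat{\mathcal K}$ and $\hat A_{\lambda+i0}(r_\lambda)=T_{\lambda+i0}(\hat H_{r_\lambda})\hat J$. $\Upsilon^j_{\lambda+i0}(r_\lambda)=\{u\in\mathcal K:(1+(r_\lambda-s)T_{\lambda+i0}(H_s)J)^ju=0\}$, which does not depend on the non-resonant real $s$. A vector has order $j$ if it belongs to $\Upsilon^j_{\lambda+i0}(r_\lambda)$ but not to $\Upsilon^{j-1}_{\lambda+i0}(r_\lambda)$. The order of the resonance point $r_\lambda$ is the smallest positive integer $k$ with $\Upsilon^k_{\lambda+i0}(r_\lambda)=\Upsilon^{k+1}_{\lambda+i0}(r_\lambda)$.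
   Formalization: The condition α = 0 is added to the orthogonality conditions in the "if and only if": for α ≠ 0 the order is always 1, so the "if" direction as written fails (e.g. one-dimensional spaces, Ĵ = 0, ψ̂ = α = 1, Ĥ = 0, λ = 1). *)

theory Defs
  imports "HOL-Analysis.Analysis"
begin

section \<open>Complex Hilbert spaces\<close>

text \<open>The scalar product is linear in the second argument. Separability is not part of the class.\<close>

class chilbert = real_normed_vector + complete_space +
  fixes scaleC :: "complex \<Rightarrow> 'a \<Rightarrow> 'a" (infixr \<open>*\<^sub>C\<close> 75)
    and cinner :: "'a \<Rightarrow> 'a \<Rightarrow> complex"
  assumes scaleC_add_right: "a *\<^sub>C (x + y) = a *\<^sub>C x + a *\<^sub>C y"
    and scaleC_add_left: "(a + b) *\<^sub>C x = a *\<^sub>C x + b *\<^sub>C x"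
    and scaleC_scaleC: "a *\<^sub>C (b *\<^sub>C x) = (a * b) *\<^sub>C x"
    and scaleC_one: "1 *\<^sub>C x = x"
    and scaleR_scaleC: "t *\<^sub>R x = complex_of_real t *\<^sub>C x"
    and cinner_commute: "cinner x y = cnj (cinner y x)"
    and cinner_add_right: "cinner x (y + z) = cinner x y + cinner x z"
    and cinner_scaleC_right: "cinner x (a *\<^sub>C y) = a * cinner x y"
    and cinner_self: "cinner x x = complex_of_real ((norm x)\<^sup>2)"

global_interpretation complex_vector: vector_space "scaleC :: complex \<Rightarrow> 'a \<Rightarrow> 'a::chilbert"
  by standard (simp_all add: scaleC_add_right scaleC_add_left scaleC_scaleC scaleC_one)

instantiation complex :: chilbert
begin

definition scaleC_complex :: "complex \<Rightarrow> complex \<Rightarrow> complex"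
  where "scaleC_complex a x = a * x"

definition cinner_complex :: "complex \<Rightarrow> complex \<Rightarrow> complex"
  where "cinner_complex x y = cnj x * y"

instance
proof
  fix x :: complex
  show "cinner x x = complex_of_real ((norm x)\<^sup>2)"
    by (simp only: cinner_complex_def mult.commute[of "cnj x" x] complex_norm_square)
qed (simp_all add: scaleC_complex_def cinner_complex_def algebra_simps scaleR_conv_of_real)

end

text \<open>The Hilbert direct sum, with the norm that the library already puts on products.\<close>

instantiation prod :: (chilbert, chilbert) chilbert
begin

definition scaleC_prod :: "complex \<Rightarrow> 'a \<times> 'b \<Rightarrow> 'a \<times> 'b"
  where "scaleC_prod a x = (a *\<^sub>C fst x, a *\<^sub>C snd x)"

definition cinner_prod :: "'a \<times> 'b \<Rightarrow> 'a \<times> 'b \<Rightarrow> complex"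
  where "cinner_prod x y = cinner (fst x) (fst y) + cinner (snd x) (snd y)"

instance
proof
  fix x y :: "'a \<times> 'b"
  show "cinner x x = complex_of_real ((norm x)\<^sup>2)"
    by (simp add: cinner_prod_def norm_prod_def cinner_self)
  show "cinner x y = cnj (cinner y x)"
    by (simp add: cinner_prod_def flip: cinner_commute)
qed (simp_all add: scaleC_prod_def cinner_prod_def prod_eq_iff algebra_simps scaleC_add_right
      scaleC_add_left scaleC_scaleC scaleC_one scaleR_scaleC cinner_add_right cinner_scaleC_right)

end

section \<open>Unbounded operators\<close>

text \<open>
  An operator is a partial map whose graph is a complex subspace; its domain is \<^const>\<open>dom\<close>,
  composition with the natural domain is \<^const>\<open>map_comp\<close>, and an everywhere defined
  function \<open>f\<close> is the partial map \<open>Some \<circ> f\<close>.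
\<close>

definition linear_op :: "('a::chilbert \<rightharpoonup> 'b::chilbert) \<Rightarrow> bool"
  where "linear_op T \<longleftrightarrow> complex_vector.subspace (Map.graph T)"

definition closed_op :: "('a::chilbert \<rightharpoonup> 'b::chilbert) \<Rightarrow> bool"
  where "closed_op T \<longleftrightarrow> closed (Map.graph T)"

definition densely_defined :: "('a::chilbert \<rightharpoonup> 'b::chilbert) \<Rightarrow> bool"
  where "densely_defined T \<longleftrightarrow> closure (dom T) = UNIV"

definition op_ker :: "('a::chilbert \<rightharpoonup> 'b::chilbert) \<Rightarrow> 'a set"
  where "op_ker T = {x. T x = Some 0}"

text \<open>For a densely defined \<open>T\<close> the vector \<open>z\<close> below is automatically unique.\<close>

definition adj :: "('a::chilbert \<rightharpoonup> 'b::chilbert) \<Rightarrow> ('b \<rightharpoonup> 'a)"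
  where "adj T y =
    (if \<exists>!z. \<forall>x v. T x = Some v \<longrightarrow> cinner y v = cinner z x
     then Some (THE z. \<forall>x v. T x = Some v \<longrightarrow> cinner y v = cinner z x) else None)"

definition selfadjoint :: "('a::chilbert \<rightharpoonup> 'a) \<Rightarrow> bool"
  where "selfadjoint T \<longleftrightarrow> linear_op T \<and> densely_defined T \<and> adj T = T"

definition op_add :: "('a::chilbert \<rightharpoonup> 'b::chilbert) \<Rightarrow> ('a \<rightharpoonup> 'b) \<Rightarrow> ('a \<rightharpoonup> 'b)"
  where "op_add S T x =
    (case (S x, T x) of (Some u, Some v) \<Rightarrow> Some (u + v) | _ \<Rightarrow> None)"

definition op_scale :: "complex \<Rightarrow> ('a::chilbert \<rightharpoonup> 'b::chilbert) \<Rightarrow> ('a \<rightharpoonup> 'b)"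
  where "op_scale c T x = map_option (\<lambda>u. c *\<^sub>C u) (T x)"

definition op_inv :: "('a::chilbert \<rightharpoonup> 'b::chilbert) \<Rightarrow> ('b \<rightharpoonup> 'a)"
  where "op_inv T y = (if \<exists>!x. T x = Some y then Some (THE x. T x = Some y) else None)"

definition op_direct_sum ::
  "('a::chilbert \<rightharpoonup> 'b::chilbert) \<Rightarrow> ('c::chilbert \<rightharpoonup> 'd::chilbert) \<Rightarrow> ('a \<times> 'c \<rightharpoonup> 'b \<times> 'd)"
  where "op_direct_sum S T p =
    (case (S (fst p), T (snd p)) of (Some u, Some v) \<Rightarrow> Some (u, v) | _ \<Rightarrow> None)"

definition resolvent :: "('a::chilbert \<rightharpoonup> 'a) \<Rightarrow> complex \<Rightarrow> ('a \<rightharpoonup> 'a)"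
  where "resolvent T z = op_inv (op_add T (Some \<circ> (\<lambda>x. (- z) *\<^sub>C x)))"

definition eigenspace :: "('a::chilbert \<rightharpoonup> 'a) \<Rightarrow> complex \<Rightarrow> 'a set"
  where "eigenspace T c = {x. T x = Some (c *\<^sub>C x)}"

section \<open>Compactness\<close>

text \<open>
  The type of bounded real-linear maps supplies the operator norm. Its elements used below are
  complex-linear, because they agree with a complex-linear operator on a dense subspace.
\<close>

definition compact_op :: "('a::chilbert \<Rightarrow>\<^sub>L 'b::chilbert) \<Rightarrow> bool"
  where "compact_op B \<longleftrightarrow> compact (closure (blinfun_apply B ` cball 0 1))"

definition extends_to :: "('a::chilbert \<rightharpoonup> 'b::chilbert) \<Rightarrow> ('a \<Rightarrow>\<^sub>L 'b) \<Rightarrow> bool"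
  where "extends_to A B \<longleftrightarrow> A \<subseteq>\<^sub>m (Some \<circ> blinfun_apply B)"

definition extends_to_compact :: "('a::chilbert \<rightharpoonup> 'b::chilbert) \<Rightarrow> bool"
  where "extends_to_compact A \<longleftrightarrow> densely_defined A \<and> (\<exists>B. compact_op B \<and> extends_to A B)"

definition bounded_extension :: "('a::chilbert \<rightharpoonup> 'b::chilbert) \<Rightarrow> ('a \<Rightarrow>\<^sub>L 'b)"
  where "bounded_extension A = (THE B. extends_to A B)"

definition relatively_compact :: "('a::chilbert \<rightharpoonup> 'a) \<Rightarrow> ('a \<rightharpoonup> 'a) \<Rightarrow> bool"
  where "relatively_compact C A \<longleftrightarrow> dom A \<subseteq> dom C \<and>
    (\<exists>B. compact_op B \<and> C \<circ>\<^sub>m resolvent A (- \<i>) = Some \<circ> blinfun_apply B)"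

section \<open>Sandwiched resolvents and resonance points\<close>

definition sandwiched_resolvent ::
  "('h::chilbert \<rightharpoonup> 'k::chilbert) \<Rightarrow> ('h \<rightharpoonup> 'h) \<Rightarrow> complex \<Rightarrow> ('k \<rightharpoonup> 'k)"
  where "sandwiched_resolvent F H z = F \<circ>\<^sub>m resolvent H z \<circ>\<^sub>m adj F"

definition T_op :: "('h::chilbert \<rightharpoonup> 'k::chilbert) \<Rightarrow> ('h \<rightharpoonup> 'h) \<Rightarrow> complex \<Rightarrow> ('k \<Rightarrow>\<^sub>L 'k)"
  where "T_op F H z = bounded_extension (sandwiched_resolvent F H z)"

definition norm_limit_exists ::
  "('h::chilbert \<rightharpoonup> 'k::chilbert) \<Rightarrow> ('h \<rightharpoonup> 'h) \<Rightarrow> real \<Rightarrow> bool"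
  where "norm_limit_exists F H \<mu> \<longleftrightarrow>
    (\<exists>L. ((\<lambda>y. T_op F H (Complex \<mu> y)) \<longlongrightarrow> L) (at_right 0))"

definition T_lim :: "('h::chilbert \<rightharpoonup> 'k::chilbert) \<Rightarrow> ('h \<rightharpoonup> 'h) \<Rightarrow> real \<Rightarrow> ('k \<Rightarrow>\<^sub>L 'k)"
  where "T_lim F H \<mu> = Lim (at_right 0) (\<lambda>y. T_op F H (Complex \<mu> y))"

text \<open>
  The corner \<open>\<alpha>\<close> is the first-order shift of the eigenvalue along \<open>V\<close>. If \<open>\<alpha> \<noteq> 0\<close>
  then the resonance point has order 1 whatever \<open>\<psi>\<close> is, so a characterization of order
  \<open>d \<ge> 2\<close> by orthogonality to \<open>\<psi>\<close> has to include \<open>\<alpha> = 0\<close>.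
\<close>

definition block_J :: "('k::chilbert \<Rightarrow>\<^sub>L 'k) \<Rightarrow> 'k \<Rightarrow> real \<Rightarrow> 'k \<times> complex \<Rightarrow> 'k \<times> complex"
  where "block_J Jh \<psi> \<alpha> p =
    (blinfun_apply Jh (fst p) + snd p *\<^sub>C \<psi>, cinner \<psi> (fst p) + complex_of_real \<alpha> * snd p)"

text \<open>
  The line of operators is \<open>H\<close>, the resonance point is \<open>r\<close>, and \<open>s\<close> is the non-resonant point
  from which it is viewed; the space does not depend on the choice of \<open>s\<close>, but this is a theorem,
  so \<open>s\<close> stays a parameter here.
\<close>

definition Upsilon ::
  "('h::chilbert \<rightharpoonup> 'k::chilbert) \<Rightarrow> ('k \<Rightarrow> 'k) \<Rightarrow> (real \<Rightarrow> 'h \<rightharpoonup> 'h) \<Rightarrow> real \<Rightarrow> real \<Rightarrow> real \<Rightarrow> nat \<Rightarrow> 'k set"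
  where "Upsilon F J H lam r s j =
    {u. ((\<lambda>v. v + (r - s) *\<^sub>R blinfun_apply (T_lim F (H s) lam) (J v)) ^^ j) u = 0}"

definition vector_has_order ::
  "('h::chilbert \<rightharpoonup> 'k::chilbert) \<Rightarrow> ('k \<Rightarrow> 'k) \<Rightarrow> (real \<Rightarrow> 'h \<rightharpoonup> 'h) \<Rightarrow> real \<Rightarrow> real \<Rightarrow> real \<Rightarrow> 'k \<Rightarrow> nat \<Rightarrow> bool"
  where "vector_has_order F J H lam r s u j \<longleftrightarrow>
    1 \<le> j \<and> u \<in> Upsilon F J H lam r s j \<and> u \<notin> Upsilon F J H lam r s (j - 1)"

text \<open>A relation rather than a \<open>LEAST\<close>, so that nothing is claimed if the chain never stabilizes.\<close>

definition resonance_point_has_order ::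
  "('h::chilbert \<rightharpoonup> 'k::chilbert) \<Rightarrow> ('k \<Rightarrow> 'k) \<Rightarrow> (real \<Rightarrow> 'h \<rightharpoonup> 'h) \<Rightarrow> real \<Rightarrow> real \<Rightarrow> real \<Rightarrow> nat \<Rightarrow> bool"
  where "resonance_point_has_order F J H lam r s d \<longleftrightarrow>
    1 \<le> d \<and> Upsilon F J H lam r s d = Upsilon F J H lam r s (d + 1) \<and>
    (\<forall>k. 1 \<le> k \<and> k < d \<longrightarrow> Upsilon F J H lam r s k \<noteq> Upsilon F J H lam r s (k + 1))"

end

theory Submission
  imports Defs
begin

text \<open>
  Let \<open>t = s - r\<close>, let \<open>W\<close> be the limit \<open>T\<close> at a non-resonant point \<open>s\<close> and \<open>B = 1 - t W J\<close>, so that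
  \<open>\<Upsilon>\<^sup>j\<close> is the kernel of \<open>B\<^sup>j\<close>. For \<open>z = \<lambda> + iy\<close> the operator \<open>T\<^sub>z(H\<^sub>r)\<close> is block
  diagonal with corner \<open>i/y\<close>. Multiplying the second component of the resolvent identities by \<open>y\<close>
  and letting \<open>y\<close> tend to 0 removes this singularity. With \<open>l x\<close> the second component of
  \<open>J x\<close>, and \<open>S x\<close> the vector whose first component is the limit of \<open>T\<^sub>z(\<close>hat \<open>H\<^sub>r)\<close> applied to
  the first component of \<open>J x\<close> and whose second component is 0, the limits say: \<open>B\<close> kills
  \<open>v\<^sub>0 = (0, 1)\<close>; if \<open>B w = x\<close> then \<open>l x = 0\<close> and \<open>w - x - t S x\<close> is a multiple of \<open>v\<^sub>0\<close>; and
  if \<open>l x = 0\<close> then \<open>t B (S x) = x - B x\<close>. Hence \<open>v\<^sub>0, S v\<^sub>0, S\<^sup>2 v\<^sub>0, \<dots>\<close> climb the chain of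
  kernels one dimension at a time until \<open>l\<close> first fails to vanish on one of them, and there
  the chain stops.
\<close>

section \<open>Kernels of powers along a ladder of vectors\<close>

text \<open>Isolates the algebra from the analysis: the resolvents enter the chain of kernels only
  through these rules for \<open>B\<close>, \<open>S\<close> and \<open>l\<close>, so the chain is
  studied over any field, without topology.\<close>

locale ladder = vector_space scale
  for scale :: "'f::field \<Rightarrow> 'v::ab_group_add \<Rightarrow> 'v" +
  fixes B S :: "'v \<Rightarrow> 'v" and l :: "'v \<Rightarrow> 'f" and v0 :: 'v and t :: 'f
  assumes linear_B: "Vector_Spaces.linear scale scale B"
    and linear_S: "Vector_Spaces.linear scale scale S"
    and linear_l: "Vector_Spaces.linear scale (*) l"
    and t_nonzero: "t \<noteq> 0"
    and v0_nonzero: "v0 \<noteq> 0"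
    and B_v0: "B v0 = 0"
    and l_B: "l (B w) = 0"
    and preimage_B: "w - B w - scale t (S (B w)) \<in> span {v0}"
    and B_S: "l x = 0 \<Longrightarrow> scale t (B (S x)) = x - B x"
begin

sublocale B: Vector_Spaces.linear scale scale B by (rule linear_B)
sublocale S: Vector_Spaces.linear scale scale S by (rule linear_S)
sublocale l: Vector_Spaces.linear scale "(*)" l by (rule linear_l)

definition Y :: "nat \<Rightarrow> 'v set"
  where "Y j = {u. (B ^^ j) u = 0}"

definition rung :: "nat \<Rightarrow> 'v"
  where "rung i = (S ^^ i) v0"

lemma rung_0: "rung 0 = v0" and rung_Suc: "rung (Suc i) = S (rung i)"
  by (simp_all add: rung_def)

lemma linear_B_power: "Vector_Spaces.linear scale scale (B ^^ j)"
proof (induction j)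
  case 0
  show ?case by (simp add: linear_id id_def[symmetric] del: id_apply)
next
  case (Suc j)
  show ?case
    using Vector_Spaces.linear_compose[OF Suc linear_B] by (simp add: o_def)
qed

lemma subspace_Y: "subspace (Y j)"
proof -
  interpret Bj: Vector_Spaces.linear scale scale "B ^^ j" by (rule linear_B_power)
  show ?thesis
    by (auto simp: Y_def subspace_def Bj.add Bj.scale Bj.zero)
qed

lemma B_power_zero: "(B ^^ j) 0 = 0"
  by (induction j) (simp_all add: B.zero)

lemma Y_mono: "i \<le> j \<Longrightarrow> Y i \<subseteq> Y j"
  by (auto simp: Y_def funpow_add B_power_zero dest!: le_Suc_ex simp: add.commute)

lemma mem_Y_Suc: "w \<in> Y (Suc j) \<longleftrightarrow> B w \<in> Y j"
  by (simp add: Y_def funpow_swap1)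

text \<open>This is \<open>B_S\<close> at \<open>rung j\<close> pushed through
  \<open>B ^^ k\<close>. Up to the factor \<open>t\<close>, one application of \<open>B\<close>
  brings the next rung back to the present one, modulo a term of lower order.\<close>

lemma B_power_rung_Suc:
  assumes "l (rung j) = 0"
  shows "scale t ((B ^^ Suc k) (rung (Suc j))) = (B ^^ k) (rung j) - (B ^^ Suc k) (rung j)"
proof -
  interpret Bk: Vector_Spaces.linear scale scale "B ^^ k" by (rule linear_B_power)
  have "scale t ((B ^^ Suc k) (rung (Suc j))) = (B ^^ k) (scale t (B (S (rung j))))"
    by (simp add: funpow_swap1 Bk.scale rung_Suc)
  also have "\<dots> = (B ^^ k) (rung j) - (B ^^ Suc k) (rung j)"
    by (simp add: B_S assms Bk.diff funpow_swap1)
  finally show ?thesis .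
qed

text \<open>By induction, the power of \<open>B\<close> that kills \<open>rung j\<close> sends
  \<open>rung (Suc j)\<close> to the nonzero vector \<open>(B ^^ j) (rung j)\<close> divided by
  \<open>t\<close>, and one more power kills it.\<close>

lemma rung_order:
  assumes "\<And>i. i < j \<Longrightarrow> l (rung i) = 0"
  shows "rung j \<in> Y (Suc j) \<and> rung j \<notin> Y j"
  using assms
proof (induction j)
  case 0
  show ?case by (simp add: Y_def rung_0 B_v0 v0_nonzero)
next
  case (Suc j)
  then have IH: "(B ^^ Suc j) (rung j) = 0" "(B ^^ j) (rung j) \<noteq> 0" and l: "l (rung j) = 0"
    by (auto simp: Y_def)
  have "scale t ((B ^^ Suc j) (rung (Suc j))) = (B ^^ j) (rung j)"
    unfolding B_power_rung_Suc[OF l] IH by simp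
  moreover have "(B ^^ Suc (Suc j)) (rung j) = 0"
    using IH(1) by (simp add: B.zero)
  then have "scale t ((B ^^ Suc (Suc j)) (rung (Suc j))) = 0"
    unfolding B_power_rung_Suc[OF l] IH by simp
  ultimately show ?case
    using IH(2) t_nonzero unfolding Y_def by (auto simp del: funpow.simps)
qed

text \<open>By \<open>preimage_B\<close>, a vector \<open>w\<close> is recovered from
  \<open>B w\<close> as \<open>B w + t S (B w)\<close> up to a multiple of \<open>v0\<close>, and
  \<open>S\<close> moves every rung up by one. The functional \<open>l\<close> may be nonzero on the
  last rung \<open>j - 1\<close>, since the order of a rung depends only on the earlier
  ones.\<close>

lemma Y_eq_span:
  assumes "\<And>i. Suc i < j \<Longrightarrow> l (rung i) = 0"
  shows "Y j = span (rung ` {..<j})"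
proof
  have "rung i \<in> Y j" if "i < j" for i
    using rung_order[of i] Y_mono[of "Suc i" j] assms that by fastforce
  then show "span (rung ` {..<j}) \<subseteq> Y j"
    by (intro span_minimal subspace_Y) auto
  show "Y j \<subseteq> span (rung ` {..<j})"
    using assms
  proof (induction j)
    case 0
    show ?case by (simp add: Y_def)
  next
    case (Suc j)
    let ?V = "span (rung ` {..<Suc j})"
    show ?case
    proof
      fix w assume "w \<in> Y (Suc j)"
      with Suc have Bw: "B w \<in> span (rung ` {..<j})"
        by (auto simp: mem_Y_Suc)
      have "S (B w) \<in> span (S ` rung ` {..<j})"
        using Bw S.span_image[of "rung ` {..<j}"] by blast
      moreover have "S ` rung ` {..<j} \<subseteq> rung ` {..<Suc j}"
        by (force simp: rung_Suc[symmetric])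
      ultimately have S: "S (B w) \<in> ?V"
        using span_mono by blast
      have "rung ` {..<j} \<subseteq> rung ` {..<Suc j}"
        by auto
      then have B: "B w \<in> ?V"
        using Bw span_mono by blast
      have "{v0} \<subseteq> rung ` {..<Suc j}"
        using rung_0 by (auto intro!: image_eqI[of _ _ 0])
      then have "w - B w - scale t (S (B w)) \<in> ?V"
        using preimage_B[of w] span_mono by blast
      from span_add[OF span_add[OF this span_scale[OF S, of t]] B] show "w \<in> ?V"
        by simp
    qed
  qed
qed

text \<open>Each rung has a larger order than its predecessors, so it lies outside the kernel that
  they span.\<close>

lemma independent_rungs:
  assumes "\<And>i. Suc i < j \<Longrightarrow> l (rung i) = 0"
  shows "independent (rung ` {..<j}) \<and> card (rung ` {..<j}) = j"
  using assms
proof (induction j)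
  case 0
  show ?case by (simp add: independent_empty)
next
  case (Suc j)
  then have IH: "independent (rung ` {..<j})" "card (rung ` {..<j}) = j"
    by auto
  have "rung j \<notin> span (rung ` {..<j})"
    using rung_order[of j] Y_eq_span[of j] Suc.prems by simp
  moreover from this have "rung j \<notin> rung ` {..<j}"
    using span_base[of "rung j" "rung ` {..<j}"] by metis
  ultimately show ?case
    using IH by (simp add: lessThan_Suc independent_insertI)
qed

lemma dim_Y:
  assumes "\<And>i. Suc i < j \<Longrightarrow> l (rung i) = 0"
  shows "dim (Y j) = j"
proof -
  have "Y j = span (rung ` {..<j})"
    by (rule Y_eq_span) (rule assms)
  moreover have "independent (rung ` {..<j}) \<and> card (rung ` {..<j}) = j"
    by (rule independent_rungs) (rule assms)
  ultimately show ?thesis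
    by (metis dim_span_eq_card_independent)
qed

text \<open>The range of \<open>B\<close> lies in the kernel of \<open>l\<close>. If
  \<open>B w\<close> is a combination of the rungs up to \<open>n\<close>, then \<open>l\<close>
  vanishes on it and on all these rungs except the last, so the coefficient of \<open>rung n\<close>
  is 0 and \<open>w\<close> already lies one kernel lower.\<close>

lemma Y_stable:
  assumes zero: "\<And>i. i < n \<Longrightarrow> l (rung i) = 0" and nonzero: "l (rung n) \<noteq> 0"
  shows "Y (Suc (Suc n)) = Y (Suc n)"
proof
  show "Y (Suc n) \<subseteq> Y (Suc (Suc n))"
    by (rule Y_mono) simp
  show "Y (Suc (Suc n)) \<subseteq> Y (Suc n)"
  proof
    fix w assume "w \<in> Y (Suc (Suc n))"
    then have "B w \<in> span (insert (rung n) (rung ` {..<n}))"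
      using Y_eq_span[of "Suc n"] zero by (simp add: mem_Y_Suc lessThan_Suc)
    then obtain c where c: "B w - scale c (rung n) \<in> span (rung ` {..<n})"
      unfolding span_breakdown_eq by (rule exE)
    have "subspace {x. l x = 0}"
      by (auto simp: subspace_def l.add l.scale l.zero)
    then have "span (rung ` {..<n}) \<subseteq> {x. l x = 0}"
      using zero by (intro span_minimal) auto
    then have "c * l (rung n) = 0"
      using c l_B[of w] by (auto simp: l.diff l.scale)
    then have "B w \<in> span (rung ` {..<n})"
      using c nonzero by simp
    then show "w \<in> Y (Suc n)"
      using Y_eq_span[of n] zero by (simp add: mem_Y_Suc)
  qed
qed

lemma Y_increasing:
  assumes "\<And>i. i < k \<Longrightarrow> l (rung i) = 0"
  shows "Y k \<noteq> Y (Suc k)"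
  using rung_order[of k] assms by blast

lemma stable_iff:
  "Y (Suc n) = Y (Suc (Suc n)) \<and> (\<forall>k. 1 \<le> k \<and> k \<le> n \<longrightarrow> Y k \<noteq> Y (Suc k))
    \<longleftrightarrow> (\<forall>i<n. l (rung i) = 0) \<and> l (rung n) \<noteq> 0" (is "?L \<longleftrightarrow> ?R")
proof
  assume R: ?R
  have "Y (Suc n) = Y (Suc (Suc n))"
    by (rule Y_stable[symmetric]) (use R in auto)
  moreover have "Y k \<noteq> Y (Suc k)" if "k \<le> n" for k
    by (rule Y_increasing) (use R that in auto)
  ultimately show ?L
    by blast
next
  assume L: ?L
  \<comment> \<open>The first obstructed rung exists, as otherwise the chain would grow forever. If
    \<open>m < n\<close> the chain would stop too early, and if \<open>m > n\<close> it would still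
    grow at \<open>Suc n\<close>.\<close>
  define m where "m = (LEAST i. l (rung i) \<noteq> 0)"
  have "\<exists>i. l (rung i) \<noteq> 0"
    using L Y_increasing[of "Suc n"] by blast
  then have m: "l (rung m) \<noteq> 0" "\<And>i. i < m \<Longrightarrow> l (rung i) = 0"
    unfolding m_def by (rule LeastI_ex, metis not_less_Least)
  have "\<not> Suc m \<le> n"
  proof
    assume "Suc m \<le> n"
    with L have "Y (Suc m) \<noteq> Y (Suc (Suc m))"
      by simp
    with Y_stable[OF m(2) m(1)] show False by simp
  qed
  moreover have "\<not> Suc n \<le> m"
  proof
    assume "Suc n \<le> m"
    then have "Y (Suc n) \<noteq> Y (Suc (Suc n))"
      by (intro Y_increasing m(2)) simp
    with L show False by blast
  qed
  ultimately have "m = n" by simp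
  with m show ?R by simp
qed

end

section \<open>Hilbert spaces and unbounded operators\<close>

lemma cinner_zero_right [simp]: "cinner x 0 = 0"
  using cinner_add_right[of x 0 0] by simp

lemma cinner_add_left: "cinner (x + y) z = cinner x z + cinner y z"
  by (metis cinner_commute cinner_add_right complex_cnj_add)

lemma cinner_diff_left: "cinner (x - y) z = cinner x z - cinner y z"
  using cinner_add_left[of "x - y" y z] by simp

lemma cinner_scaleC_left: "cinner (a *\<^sub>C x) y = cnj a * cinner x y"
  by (metis cinner_commute cinner_scaleC_right complex_cnj_mult)

lemma cinner_zero_left [simp]: "cinner 0 x = 0"
  using cinner_add_left[of 0 0 x] by simp

lemma cinner_self_eq_0 [simp]: "cinner x x = 0 \<longleftrightarrow> x = 0"
  by (simp add: cinner_self)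

text \<open>The class ties the norm to complex scalars through \<open>cinner_self\<close> alone, so
  homogeneity is read off from the scalar product.\<close>

lemma norm_scaleC: "norm (a *\<^sub>C x) = cmod a * norm x" for x :: "'a::chilbert"
proof -
  have "complex_of_real ((norm (a *\<^sub>C x))\<^sup>2) = cnj a * (a * cinner x x)"
    unfolding cinner_self[symmetric] by (simp add: cinner_scaleC_left cinner_scaleC_right)
  also have "\<dots> = complex_of_real ((cmod a)\<^sup>2) * complex_of_real ((norm x)\<^sup>2)"
    by (simp add: cinner_self complex_norm_square mult.commute flip: of_real_power)
  also have "\<dots> = complex_of_real ((cmod a * norm x)\<^sup>2)"
    by (simp add: power_mult_distrib)
  finally have "(norm (a *\<^sub>C x))\<^sup>2 = (cmod a * norm x)\<^sup>2"
    by (simp only: of_real_eq_iff)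
  then show ?thesis
    by (simp add: power2_eq_iff_nonneg)
qed

lemma fst_scaleC: "fst (a *\<^sub>C p) = a *\<^sub>C fst p"
  by (simp add: scaleC_prod_def)

lemma snd_scaleC: "snd (a *\<^sub>C p) = a * snd p" for p :: "'a::chilbert \<times> complex"
  by (simp add: scaleC_prod_def scaleC_complex_def)

lemma bounded_linear_scaleC_right: "bounded_linear (\<lambda>x::'a::chilbert. a *\<^sub>C x)"
  by (rule bounded_linear_intro[of _ "cmod a"])
    (simp_all add: scaleC_add_right scaleR_scaleC scaleC_scaleC norm_scaleC mult.commute)

lemma bounded_linear_scaleC_left: "bounded_linear (\<lambda>a. a *\<^sub>C (x::'a::chilbert))"
  by (rule bounded_linear_intro[of _ "norm x"])
    (simp_all add: scaleC_add_left scaleR_scaleC scaleC_scaleC norm_scaleC scaleC_complex_def)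

lemma Re_cinner: "Re (cinner x y) = ((norm (x + y))\<^sup>2 - (norm x)\<^sup>2 - (norm y)\<^sup>2) / 2"
proof -
  have "complex_of_real ((norm (x + y))\<^sup>2) =
      complex_of_real ((norm x)\<^sup>2) + complex_of_real ((norm y)\<^sup>2) + (cinner x y + cnj (cinner x y))"
    unfolding cinner_self[symmetric]
    by (simp add: cinner_add_left cinner_add_right flip: cinner_commute)
  from arg_cong[OF this, of Re] show ?thesis
    by simp
qed

text \<open>Polarization expresses the scalar product by norms, so no Cauchy-Schwarz inequality is needed.\<close>

lemma continuous_on_cinner [continuous_intros]:
  fixes f :: "'a::topological_space \<Rightarrow> 'b::chilbert"
  assumes "continuous_on A f"
  shows "continuous_on A (\<lambda>a. cinner x (f a))"
proof -
  \<comment> \<open>The product is conjugate-linear in its first argument, so a factor \<i> there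
    turns the imaginary part into a real part, to which polarization applies.\<close>
  have "cinner x y =
      Complex (Re (cinner x y)) (Re (cinner (\<i> *\<^sub>C x) y))" for y :: 'b
    by (simp add: cinner_scaleC_left complex_eq_iff)
  then have *: "cinner x y =
      complex_of_real (Re (cinner x y)) + \<i> * complex_of_real (Re (cinner (\<i> *\<^sub>C x) y))" for y :: 'b
    by (metis Complex_eq)
  show ?thesis
    by (subst *, unfold Re_cinner) (intro continuous_intros assms, simp_all)
qed

text \<open>Identities for bounded extensions are checked by algebra on the domain of a sandwiched
  resolvent and carried to the whole space by this principle.\<close>

lemma dense_ext:
  fixes f g :: "'a::topological_space \<Rightarrow> 'b::t2_space"
  assumes "closure A = UNIV" "continuous_on UNIV f" "continuous_on UNIV g"
    and "\<And>x. x \<in> A \<Longrightarrow> f x = g x"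
  shows "f x = g x"
proof -
  have "closed {x. f x = g x}"
    using assms by (intro closed_Collect_eq) auto
  then have "closure A \<subseteq> {x. f x = g x}"
    using assms(4) by (intro closure_minimal) auto
  then show ?thesis
    using assms(1) by auto
qed

section \<open>Adjoints, self-adjoint operators and resolvents\<close>

lemma adj_eq_Some_iff:
  assumes "densely_defined T"
  shows "adj T y = Some z \<longleftrightarrow> (\<forall>x v. T x = Some v \<longrightarrow> cinner y v = cinner z x)"
proof -
  \<comment> \<open>Two candidates give the same functional on a dense domain, hence everywhere, so
    their difference is orthogonal to itself.\<close>
  have unique: "z = z'"
    if z: "\<forall>x v. T x = Some v \<longrightarrow> cinner y v = cinner z x"
      and z': "\<forall>x v. T x = Some v \<longrightarrow> cinner y v = cinner z' x" for z z'
  proof -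
    have "cinner z x = cinner z' x" if "x \<in> dom T" for x
      using that z z' by (metis domD)
    then have "cinner z x = cinner z' x" for x
      using dense_ext[of "dom T" "cinner z" "cinner z'" x] assms
      by (simp add: densely_defined_def continuous_intros)
    then have "cinner (z - z') (z - z') = 0"
      by (simp only: cinner_diff_left diff_self)
    then show ?thesis by simp
  qed
  let ?P = "\<lambda>z. \<forall>x v. T x = Some v \<longrightarrow> cinner y v = cinner z x"
  show ?thesis
  proof
    assume "adj T y = Some z"
    then have *: "(if \<exists>!z. ?P z then Some (THE z. ?P z) else None) = Some z"
      by (simp only: adj_def)
    have ex: "\<exists>!z. ?P z"
    proof (rule ccontr)
      assume "\<not> (\<exists>!z. ?P z)"
      with * show False by (simp only: if_False option.distinct)
    qed
    then have z: "z = (THE z. ?P z)"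
      using * by (simp only: if_True option.inject)
    show "?P z"
      unfolding z by (rule theI'[OF ex])
  next
    assume z: "?P z"
    have "\<exists>!z. ?P z"
      by (rule ex1I[of ?P, OF z]) (rule unique[OF _ z])
    moreover have "(THE z. ?P z) = z"
      by (rule the_equality[of ?P, OF z]) (rule unique[OF _ z])
    ultimately show "adj T y = Some z"
      unfolding adj_def by (simp only: if_True)
  qed
qed

lemma linear_op_iff:
  "linear_op T \<longleftrightarrow> T 0 = Some 0 \<and>
    (\<forall>x v y w. T x = Some v \<longrightarrow> T y = Some w \<longrightarrow> T (x + y) = Some (v + w)) \<and>
    (\<forall>c x v. T x = Some v \<longrightarrow> T (c *\<^sub>C x) = Some (c *\<^sub>C v))"
  by (auto simp: linear_op_def complex_vector.subspace_def Map.graph_def scaleC_prod_def zero_prod_def)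

lemma
  assumes "linear_op T"
  shows linear_op_zero: "T 0 = Some 0"
    and linear_op_add: "T x = Some v \<Longrightarrow> T y = Some w \<Longrightarrow> T (x + y) = Some (v + w)"
    and linear_op_scale: "T x = Some v \<Longrightarrow> T (c *\<^sub>C x) = Some (c *\<^sub>C v)"
  using assms unfolding linear_op_iff by blast+

lemma linear_op_diff:
  assumes "linear_op T" "T x = Some v" "T y = Some w"
  shows "T (x - y) = Some (v - w)"
  using linear_op_add[OF assms(1,2) linear_op_scale[OF assms(1,3), of "- 1"]] by simp

lemma linear_op_adj:
  assumes "densely_defined T"
  shows "linear_op (adj T)"
proof -
  show ?thesis
    unfolding linear_op_iff adj_eq_Some_iff[OF assms]
    by (simp add: cinner_add_left cinner_scaleC_left)
qed

lemma selfadjoint_symmetric: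
  assumes "selfadjoint T" "T x = Some v" "T y = Some w"
  shows "cinner x w = cinner v y"
proof -
  have "densely_defined T" "adj T x = Some v"
    using assms by (auto simp: selfadjoint_def)
  then show ?thesis
    using assms(3) by (simp add: adj_eq_Some_iff)
qed

text \<open>Symmetry of \<open>B\<close> tested against the smaller operator \<open>A\<close> is
  exactly the condition \<open>adj A x = Some v\<close>, and \<open>adj A = A\<close>.\<close>

lemma selfadjoint_maximal_symmetric:
  assumes "selfadjoint A" "A \<subseteq>\<^sub>m B"
    and "\<And>x v y w. B x = Some v \<Longrightarrow> B y = Some w \<Longrightarrow> cinner x w = cinner v y"
    and "B x = Some v"
  shows "A x = Some v"
proof -
  have "densely_defined A" "adj A = A"
    using assms by (auto simp: selfadjoint_def)
  moreover have "\<forall>y w. A y = Some w \<longrightarrow> cinner x w = cinner v y"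
  proof (intro allI impI)
    fix y w assume "A y = Some w"
    then have "B y = Some w"
      using assms(2) by (metis domI map_le_def)
    then show "cinner x w = cinner v y"
      by (rule assms(3)[OF assms(4)])
  qed
  ultimately show ?thesis
    using adj_eq_Some_iff[of A x v] by simp
qed

text \<open>The partial inverse becomes a plain relation because \<open>T - z\<close> is injective:
  a vector \<open>u\<close> in its kernel would satisfy \<open>z <u,u> = cnj z <u,u>\<close> with
  \<open>z\<close> not real.\<close>

lemma resolvent_eq_Some_iff:
  assumes T: "selfadjoint T" and z: "Im z \<noteq> 0"
  shows "resolvent T z y = Some x \<longleftrightarrow> (\<exists>v. T x = Some v \<and> v - z *\<^sub>C x = y)"
proof -
  let ?A = "op_add T (Some \<circ> (\<lambda>x. (- z) *\<^sub>C x))"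
  have lin: "linear_op T"
    using T by (simp add: selfadjoint_def)
  have A: "?A x = Some y \<longleftrightarrow> (\<exists>v. T x = Some v \<and> v - z *\<^sub>C x = y)" for x y
    by (auto simp: op_add_def split: option.splits)
  have unique: "x = x'" if "?A x = Some y" "?A x' = Some y" for x x'
  proof -
    from that obtain v v' where v: "T x = Some v" "T x' = Some v'"
      and eq: "v - z *\<^sub>C x = v' - z *\<^sub>C x'"
      unfolding A by metis
    define u where "u = x - x'"
    have "v - v' = z *\<^sub>C u"
      using eq by (simp add: u_def complex_vector.scale_right_diff_distrib algebra_simps)
    then have Tu: "T u = Some (z *\<^sub>C u)"
      using linear_op_diff[OF lin v] by (simp add: u_def)
    have "z * cinner u u = cnj z * cinner u u"
      using selfadjoint_symmetric[OF T Tu Tu]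
      by (simp add: cinner_scaleC_left cinner_scaleC_right)
    moreover have "z \<noteq> cnj z"
      using z by (simp add: complex_eq_iff)
    ultimately have "u = 0"
      by simp
    then show ?thesis
      by (simp add: u_def)
  qed
  have "resolvent T z y = Some x \<longleftrightarrow> ?A x = Some y"
  proof
    assume "resolvent T z y = Some x"
    then have ex: "\<exists>!x. ?A x = Some y" and x: "x = (THE x. ?A x = Some y)"
      by (auto simp: resolvent_def op_inv_def split: if_splits)
    show "?A x = Some y"
      unfolding x by (rule theI'[OF ex])
  next
    assume x: "?A x = Some y"
    then have "\<exists>!x. ?A x = Some y"
      using unique by blast
    moreover have "(THE x. ?A x = Some y) = x"
      using x unique by blast
    ultimately show "resolvent T z y = Some x"
      by (simp add: resolvent_def op_inv_def)
  qed
  then show ?thesis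
    by (simp only: A)
qed

section \<open>Sandwiched resolvents, their bounded extensions and boundary limits\<close>

lemma sandwiched_resolvent_eq_Some_iff:
  assumes "selfadjoint H" "Im z \<noteq> 0"
  shows "sandwiched_resolvent F H z f = Some g \<longleftrightarrow>
    (\<exists>x v. H x = Some v \<and> adj F f = Some (v - z *\<^sub>C x) \<and> F x = Some g)"
  unfolding sandwiched_resolvent_def map_comp_Some_iff resolvent_eq_Some_iff[OF assms]
  by blast

lemma linear_op_sandwiched_resolvent:
  assumes "linear_op F" "densely_defined F" "selfadjoint H" "Im z \<noteq> 0"
  shows "linear_op (sandwiched_resolvent F H z)"
proof -
  have H: "linear_op H" and F': "linear_op (adj F)"
    using assms by (auto simp: selfadjoint_def linear_op_adj)
  let ?S = "sandwiched_resolvent F H z"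
  note iff = sandwiched_resolvent_eq_Some_iff[OF assms(3,4)]
  have "?S 0 = Some 0"
    unfolding iff
    using linear_op_zero[OF H] linear_op_zero[OF F'] linear_op_zero[OF assms(1)]
    by (intro exI[of _ 0]) simp
  moreover have "?S (f + g) = Some (p + q)" if "?S f = Some p" "?S g = Some q" for f g p q
  proof -
    from that obtain x v y w where *: "H x = Some v" "adj F f = Some (v - z *\<^sub>C x)" "F x = Some p"
      "H y = Some w" "adj F g = Some (w - z *\<^sub>C y)" "F y = Some q"
      unfolding iff by blast
    have "adj F (f + g) = Some ((v + w) - z *\<^sub>C (x + y))"
      using linear_op_add[OF F' *(2,5)] by (simp add: scaleC_add_right algebra_simps)
    then show ?thesis
      unfolding iff
      using linear_op_add[OF H *(1,4)] linear_op_add[OF assms(1) *(3,6)] by blast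
  qed
  moreover have "?S (c *\<^sub>C f) = Some (c *\<^sub>C p)" if "?S f = Some p" for c f p
  proof -
    from that obtain x v where *: "H x = Some v" "adj F f = Some (v - z *\<^sub>C x)" "F x = Some p"
      unfolding iff by blast
    have "adj F (c *\<^sub>C f) = Some (c *\<^sub>C v - z *\<^sub>C (c *\<^sub>C x))"
      using linear_op_scale[OF F' *(2), of c]
      by (simp add: complex_vector.scale_right_diff_distrib mult.commute)
    then show ?thesis
      unfolding iff
      using linear_op_scale[OF H *(1)] linear_op_scale[OF assms(1) *(3)] by blast
  qed
  ultimately show ?thesis
    unfolding linear_op_iff by blast
qed

text \<open>Density makes the bounded extension unique, which gives meaning to the
  \<open>THE\<close> in its definition.\<close>

lemma bounded_extension_eq:
  assumes A: "extends_to_compact A" and f: "A f = Some g"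
  shows "blinfun_apply (bounded_extension A) f = g"
proof -
  have dense: "closure (dom A) = UNIV"
    using A by (simp add: extends_to_compact_def densely_defined_def)
  obtain B where B: "extends_to A B"
    using A by (auto simp: extends_to_compact_def)
  have "B' = B" if "extends_to A B'" for B'
  proof (rule blinfun_eqI)
    fix x
    show "blinfun_apply B' x = blinfun_apply B x"
    proof (rule dense_ext[OF dense])
      show "blinfun_apply B' x = blinfun_apply B x" if "x \<in> dom A" for x
        using that B \<open>extends_to A B'\<close> by (auto simp: extends_to_def map_le_def)
    qed (intro continuous_intros)+
  qed
  then have "bounded_extension A = B"
    unfolding bounded_extension_def using B by (rule_tac the_equality)
  then show ?thesis
    using B f by (force simp: extends_to_def map_le_def dom_def)
qed

lemma bounded_extension_scaleC:
  assumes A: "extends_to_compact A" and lin: "linear_op A"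
  shows "blinfun_apply (bounded_extension A) (c *\<^sub>C f) = c *\<^sub>C blinfun_apply (bounded_extension A) f"
proof (rule dense_ext[where A = "dom A" and x = f
      and f = "\<lambda>f. blinfun_apply (bounded_extension A) (c *\<^sub>C f)"])
  show "closure (dom A) = UNIV"
    using A by (simp add: extends_to_compact_def densely_defined_def)
  show "blinfun_apply (bounded_extension A) (c *\<^sub>C f) = c *\<^sub>C blinfun_apply (bounded_extension A) f"
    if "f \<in> dom A" for f
    using that linear_op_scale[OF lin] bounded_extension_eq[OF A] by (metis domD)
  show "continuous_on UNIV (\<lambda>f. blinfun_apply (bounded_extension A) (c *\<^sub>C f))"
    by (intro continuous_intros bounded_linear.continuous_on[OF bounded_linear_scaleC_right])
  show "continuous_on UNIV (\<lambda>f. c *\<^sub>C blinfun_apply (bounded_extension A) f)"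
    by (intro continuous_intros bounded_linear.continuous_on[OF bounded_linear_scaleC_right])
qed

lemma T_lim_tendsto:
  assumes "norm_limit_exists F H lam"
  shows "((\<lambda>y. T_op F H (Complex lam y)) \<longlongrightarrow> T_lim F H lam) (at_right 0)"
  using assms tendsto_Lim[OF trivial_limit_at_right_real]
  unfolding norm_limit_exists_def T_lim_def by metis

text \<open>The type of \<open>T_lim\<close> guarantees real linearity; complex homogeneity is
  inherited from the partial operators, first by density and then in the limit. It makes
  \<open>B\<close> and \<open>S\<close> complex-linear.\<close>

lemma T_lim_scaleC:
  assumes "norm_limit_exists F H lam"
    and "linear_op F" "densely_defined F" "selfadjoint H"
    and compact: "\<And>z. Im z \<noteq> 0 \<Longrightarrow> extends_to_compact (sandwiched_resolvent F H z)"
  shows "blinfun_apply (T_lim F H lam) (c *\<^sub>C f) = c *\<^sub>C blinfun_apply (T_lim F H lam) f"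
proof (rule tendsto_unique[OF trivial_limit_at_right_real])
  note lim = T_lim_tendsto[OF assms(1)]
  show "((\<lambda>y. blinfun_apply (T_op F H (Complex lam y)) (c *\<^sub>C f))
      \<longlongrightarrow> blinfun_apply (T_lim F H lam) (c *\<^sub>C f)) (at_right 0)"
    by (intro tendsto_intros lim)
  have "((\<lambda>y. c *\<^sub>C blinfun_apply (T_op F H (Complex lam y)) f)
      \<longlongrightarrow> c *\<^sub>C blinfun_apply (T_lim F H lam) f) (at_right 0)"
    by (intro bounded_linear.tendsto[OF bounded_linear_scaleC_right] tendsto_intros lim)
  moreover have "\<forall>\<^sub>F y in at_right 0. c *\<^sub>C blinfun_apply (T_op F H (Complex lam y)) f =
      blinfun_apply (T_op F H (Complex lam y)) (c *\<^sub>C f)"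
    using eventually_at_right_less[of "0::real"]
  proof eventually_elim
    case (elim y)
    then show ?case
      using bounded_extension_scaleC[OF compact linear_op_sandwiched_resolvent] assms
      by (simp add: T_op_def)
  qed
  ultimately show "((\<lambda>y. blinfun_apply (T_op F H (Complex lam y)) (c *\<^sub>C f))
      \<longlongrightarrow> c *\<^sub>C blinfun_apply (T_lim F H lam) f) (at_right 0)"
    by (rule Lim_transform_eventually)
qed


section \<open>Resolvent identities and their limits\<close>

text \<open>The resolvent identities are derived for a continuous \<open>J\<close>; its linearity
  and block form enter in the final theorem.\<close>

locale eigenvalue_line =
  fixes Fhat :: "'h::chilbert \<rightharpoonup> 'k::chilbert"
    and Hhat :: "'h \<rightharpoonup> 'h"
    and J :: "'k \<times> complex \<Rightarrow> 'k \<times> complex"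
    and lam r :: real
    and F :: "'h \<times> complex \<rightharpoonup> 'k \<times> complex"
    and Hr V :: "'h \<times> complex \<rightharpoonup> 'h \<times> complex"
    and H :: "real \<Rightarrow> 'h \<times> complex \<rightharpoonup> 'h \<times> complex"
  assumes Fhat: "linear_op Fhat" "densely_defined Fhat"
    and Hhat: "selfadjoint Hhat"
    and F_eq: "F = op_direct_sum Fhat Some"
    and Hr_eq: "Hr = op_direct_sum Hhat (Some \<circ> (\<lambda>c. complex_of_real lam * c))"
    and V_eq: "V = adj F \<circ>\<^sub>m (Some \<circ> J) \<circ>\<^sub>m F"
    and H_eq: "H s = op_add Hr (op_scale (complex_of_real (s - r)) V)"
    and H_selfadjoint: "selfadjoint (H s)"
    and T_compact: "Im z \<noteq> 0 \<Longrightarrow> extends_to_compact (sandwiched_resolvent F (H s) z)"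
    and That_compact: "Im z \<noteq> 0 \<Longrightarrow> extends_to_compact (sandwiched_resolvent Fhat Hhat z)"
    and J_continuous: "continuous_on UNIV J"
begin

lemma F_eq_Some_iff: "F x = Some p \<longleftrightarrow> Fhat (fst x) = Some (fst p) \<and> snd x = snd p"
  by (cases p) (auto simp: F_eq op_direct_sum_def split: option.splits)

lemma Hr_eq_Some_iff:
  "Hr x = Some v \<longleftrightarrow> Hhat (fst x) = Some (fst v) \<and> snd v = complex_of_real lam * snd x"
  by (cases v) (auto simp: Hr_eq op_direct_sum_def split: option.splits)

lemma linear_op_F: "linear_op F"
  using Fhat(1) unfolding linear_op_iff F_eq_Some_iff
  by (simp add: scaleC_prod_def scaleC_complex_def)

lemma densely_defined_F: "densely_defined F"
proof -
  have "dom F = dom Fhat \<times> UNIV"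
    unfolding dom_def F_eq by (auto simp: op_direct_sum_def split: option.splits)
  then show ?thesis
    using Fhat(2) by (simp add: densely_defined_def closure_Times)
qed

lemma adj_F_eq_Some_iff: "adj F f = Some w \<longleftrightarrow> adj Fhat (fst f) = Some (fst w) \<and> snd w = snd f"
proof
  assume "adj F f = Some w"
  then have adj: "cinner f p = cinner w x" if "F x = Some p" for x p
    using that unfolding adj_eq_Some_iff[OF densely_defined_F] by blast
  \<comment> \<open>Testing on the vectors \<open>(x, 0)\<close> and \<open>(0, 1)\<close> separates
    the two components of the adjoint.\<close>
  have "cinner (fst f) v = cinner (fst w) x" if "Fhat x = Some v" for x v
    using adj[of "(x, 0)" "(v, 0)"] that by (simp add: F_eq_Some_iff cinner_prod_def)
  moreover have "snd w = snd f"
    using adj[of "(0, 1)" "(0, 1)"] linear_op_zero[OF Fhat(1)]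
    by (simp add: F_eq_Some_iff cinner_prod_def cinner_complex_def)
  ultimately show "adj Fhat (fst f) = Some (fst w) \<and> snd w = snd f"
    by (simp add: adj_eq_Some_iff[OF Fhat(2)])
next
  assume "adj Fhat (fst f) = Some (fst w) \<and> snd w = snd f"
  then show "adj F f = Some w"
    by (simp add: adj_eq_Some_iff[OF Fhat(2)] adj_eq_Some_iff[OF densely_defined_F]
        F_eq_Some_iff cinner_prod_def)
qed

lemma H_eq_Some_iff:
  "H s x = Some v \<longleftrightarrow> (\<exists>u p w. Hr x = Some u \<and> F x = Some p \<and> adj F (J p) = Some w \<and>
    v = u + complex_of_real (s - r) *\<^sub>C w)"
  by (auto simp: H_eq V_eq op_add_def op_scale_def map_comp_Some_iff split: option.splits)

text \<open>A self-adjoint operator has no proper symmetric extension, so \<open>H r\<close>, a priori restricted to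
  the domain of \<open>V\<close>, is all of \<open>Hr\<close>.\<close>

lemma Hr_dom_subset:
  assumes "Hr x = Some v"
  shows "\<exists>p w. F x = Some p \<and> adj F (J p) = Some w"
proof -
  have "H r x = Some v"
  proof (rule selfadjoint_maximal_symmetric[where A = "H r" and B = Hr])
    show "selfadjoint (H r)" "Hr x = Some v"
      by (fact H_selfadjoint, fact assms)
    show "H r \<subseteq>\<^sub>m Hr"
      unfolding map_le_def by (auto simp: H_eq_Some_iff)
    show "cinner x w = cinner v y" if "Hr x = Some v" "Hr y = Some w" for x v y w
      using that selfadjoint_symmetric[OF Hhat, of "fst x" "fst v" "fst y" "fst w"]
      by (simp add: Hr_eq_Some_iff cinner_prod_def cinner_complex_def)
  qed
  then show ?thesis
    unfolding H_eq_Some_iff by blast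
qed

lemma T_op_sandwich:
  assumes "Im z \<noteq> 0" "H s x = Some v" "adj F f = Some (v - z *\<^sub>C x)" "F x = Some p"
  shows "blinfun_apply (T_op F (H s) z) f = p"
  unfolding T_op_def
proof (rule bounded_extension_eq[OF T_compact[OF assms(1)]])
  show "sandwiched_resolvent F (H s) z f = Some p"
    unfolding sandwiched_resolvent_eq_Some_iff[OF H_selfadjoint assms(1)] using assms by blast
qed

lemma That_op_sandwich:
  assumes "Im z \<noteq> 0" "Hhat x = Some v" "adj Fhat f = Some (v - z *\<^sub>C x)" "Fhat x = Some p"
  shows "blinfun_apply (T_op Fhat Hhat z) f = p"
  unfolding T_op_def
proof (rule bounded_extension_eq[OF That_compact[OF assms(1)]])
  show "sandwiched_resolvent Fhat Hhat z f = Some p"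
    unfolding sandwiched_resolvent_eq_Some_iff[OF Hhat assms(1)] using assms by blast
qed

text \<open>With \<open>T = T_z(H_s)\<close> and \<open>T' = T_z(H_r)\<close> this is
  \<open>T = T' (1 - t J T)\<close> by components. The second one is multiplied by
  \<open>lam - z\<close> because the corner \<open>1 / (lam - z)\<close> of \<open>T'\<close> blows
  up at the eigenvalue.\<close>

lemma resolvent_identity_left:
  fixes s
  defines "t \<equiv> complex_of_real (s - r)"
  assumes z: "Im z \<noteq> 0"
  defines "T \<equiv> blinfun_apply (T_op F (H s) z)"
  shows "(fst (T f), (complex_of_real lam - z) * snd (T f)) =
    (blinfun_apply (T_op Fhat Hhat z) (fst (f - t *\<^sub>C J (T f))), snd (f - t *\<^sub>C J (T f)))"
proof (rule dense_ext[where A = "dom (sandwiched_resolvent F (H s) z)" and x = f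
      and f = "\<lambda>f. (fst (T f), (complex_of_real lam - z) * snd (T f))"
      and g = "\<lambda>f. (blinfun_apply (T_op Fhat Hhat z) (fst (f - t *\<^sub>C J (T f))),
        snd (f - t *\<^sub>C J (T f)))"])
  show "closure (dom (sandwiched_resolvent F (H s) z)) = UNIV"
    using T_compact[OF z] by (simp add: extends_to_compact_def densely_defined_def)
  have T: "continuous_on UNIV T"
    unfolding T_def by (intro continuous_intros)
  have JT: "continuous_on UNIV (\<lambda>f. t *\<^sub>C J (T f))"
    by (intro bounded_linear.continuous_on[OF bounded_linear_scaleC_right]
        continuous_on_compose2[OF J_continuous T]) simp
  show "continuous_on UNIV (\<lambda>f. (fst (T f), (complex_of_real lam - z) * snd (T f)))"
    by (intro continuous_intros T)
  show "continuous_on UNIV (\<lambda>f. (blinfun_apply (T_op Fhat Hhat z) (fst (f - t *\<^sub>C J (T f))),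
      snd (f - t *\<^sub>C J (T f))))"
    by (intro continuous_intros JT)
  fix f assume "f \<in> dom (sandwiched_resolvent F (H s) z)"
  then obtain x v p where x: "H s x = Some v" "adj F f = Some (v - z *\<^sub>C x)" "F x = Some p"
    using sandwiched_resolvent_eq_Some_iff[OF H_selfadjoint z] by blast
  obtain u w where u: "Hr x = Some u" and w: "adj F (J p) = Some w" and v: "v = u + t *\<^sub>C w"
    using x(1,3) unfolding H_eq_Some_iff t_def by auto
  note lin = linear_op_adj[OF densely_defined_F]
  have "adj F (f - t *\<^sub>C J p) = Some (v - z *\<^sub>C x - t *\<^sub>C w)"
    by (rule linear_op_diff[OF lin x(2) linear_op_scale[OF lin w]])
  \<comment> \<open>Subtracting \<open>t J p\<close> cancels the perturbation: the same
    \<open>x\<close> now solves the equation of the unperturbed resolvent.\<close>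
  then have *: "adj F (f - t *\<^sub>C J p) = Some (u - z *\<^sub>C x)"
    by (simp add: v)
  have "blinfun_apply (T_op Fhat Hhat z) (fst (f - t *\<^sub>C J p)) = fst p"
  proof (rule That_op_sandwich[OF z])
    show "Hhat (fst x) = Some (fst u)" "Fhat (fst x) = Some (fst p)"
      using u x(3) by (simp_all add: Hr_eq_Some_iff F_eq_Some_iff)
    show "adj Fhat (fst (f - t *\<^sub>C J p)) = Some (fst u - z *\<^sub>C fst x)"
      using * by (simp add: adj_F_eq_Some_iff scaleC_prod_def)
  qed
  moreover have "snd (f - t *\<^sub>C J p) = (complex_of_real lam - z) * snd p"
    using * u x(3)
    by (simp add: adj_F_eq_Some_iff Hr_eq_Some_iff F_eq_Some_iff scaleC_prod_def scaleC_complex_def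
        algebra_simps)
  moreover have "T f = p"
    unfolding T_def by (rule T_op_sandwich[OF z x])
  ultimately show "(fst (T f), (complex_of_real lam - z) * snd (T f)) =
      (blinfun_apply (T_op Fhat Hhat z) (fst (f - t *\<^sub>C J (T f))), snd (f - t *\<^sub>C J (T f)))"
    by simp
qed

text \<open>This is \<open>T (1 + t J T') = T'\<close>, applied to a vector whose second component
  is scaled by \<open>lam - z\<close>, so that its image \<open>c\<close> under \<open>T'\<close>
  stays fixed as \<open>z\<close> approaches the eigenvalue.\<close>

lemma resolvent_identity_right:
  fixes s c
  defines "t \<equiv> complex_of_real (s - r)"
  assumes z: "Im z \<noteq> 0"
  defines "q \<equiv> \<lambda>f. (blinfun_apply (T_op Fhat Hhat z) f, c)"
  shows "blinfun_apply (T_op F (H s) z) ((f, (complex_of_real lam - z) * c) + t *\<^sub>C J (q f)) = q f"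
proof (rule dense_ext[where A = "dom (sandwiched_resolvent Fhat Hhat z)" and x = f and g = q
      and f = "\<lambda>f. blinfun_apply (T_op F (H s) z)
        ((f, (complex_of_real lam - z) * c) + t *\<^sub>C J (q f))"])
  show "closure (dom (sandwiched_resolvent Fhat Hhat z)) = UNIV"
    using That_compact[OF z] by (simp add: extends_to_compact_def densely_defined_def)
  show q: "continuous_on UNIV q"
    unfolding q_def by (intro continuous_intros)
  have Jq: "continuous_on UNIV (\<lambda>f. t *\<^sub>C J (q f))"
    by (intro bounded_linear.continuous_on[OF bounded_linear_scaleC_right]
        continuous_on_compose2[OF J_continuous q]) simp
  show "continuous_on UNIV (\<lambda>f. blinfun_apply (T_op F (H s) z)
      ((f, (complex_of_real lam - z) * c) + t *\<^sub>C J (q f)))"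
    by (intro continuous_intros Jq)
  fix f assume "f \<in> dom (sandwiched_resolvent Fhat Hhat z)"
  then obtain x v p where x: "Hhat x = Some v" "adj Fhat f = Some (v - z *\<^sub>C x)" "Fhat x = Some p"
    using sandwiched_resolvent_eq_Some_iff[OF Hhat z] by blast
  have q_f: "q f = (p, c)"
    using That_op_sandwich[OF z x] by (simp add: q_def)
  have Hr: "Hr (x, c) = Some (v, complex_of_real lam * c)" and F: "F (x, c) = Some (q f)"
    using x by (simp_all add: Hr_eq_Some_iff F_eq_Some_iff q_f)
  \<comment> \<open>That \<open>J (q f)\<close> lies in the domain of \<open>adj F\<close> comes
    from equality of the domains of \<open>Hr\<close> and \<open>H r\<close>; this places
    \<open>(x, c)\<close> in the domain of \<open>H s\<close>.\<close>
  from Hr_dom_subset[OF Hr] obtain w where w: "adj F (J (q f)) = Some w"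
    unfolding F by blast
  note lin = linear_op_adj[OF densely_defined_F]
  let ?v = "(v, complex_of_real lam * c)"
  have "adj F (f, (complex_of_real lam - z) * c) = Some (?v - z *\<^sub>C (x, c))"
    using x(2) by (simp add: adj_F_eq_Some_iff scaleC_prod_def scaleC_complex_def algebra_simps)
  from linear_op_add[OF lin this linear_op_scale[OF lin w]]
  have "adj F ((f, (complex_of_real lam - z) * c) + t *\<^sub>C J (q f)) =
      Some ((?v + t *\<^sub>C w) - z *\<^sub>C (x, c))"
    by (simp add: algebra_simps)
  moreover have "H s (x, c) = Some (?v + t *\<^sub>C w)"
    unfolding H_eq_Some_iff t_def using Hr F w by blast
  ultimately show "blinfun_apply (T_op F (H s) z)
      ((f, (complex_of_real lam - z) * c) + t *\<^sub>C J (q f)) = q f"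
    using F by (intro T_op_sandwich[OF z])
qed


text \<open>The operators at \<open>H s\<close> converge while \<open>lam - z\<close> tends to 0, so
  the left-hand second component disappears. The two conclusions become \<open>preimage_B\<close>
  and \<open>l_B\<close>.\<close>

lemma T_lim_left:
  fixes s
  defines "t \<equiv> complex_of_real (s - r)"
  assumes lim: "norm_limit_exists F (H s) lam" and lim': "norm_limit_exists Fhat Hhat lam"
  defines "W \<equiv> blinfun_apply (T_lim F (H s) lam)"
  shows "fst (W f) = blinfun_apply (T_lim Fhat Hhat lam) (fst (f - t *\<^sub>C J (W f)))"
    and "snd (f - t *\<^sub>C J (W f)) = 0"
proof -
  let ?z = "\<lambda>y. Complex lam y"
  let ?T = "\<lambda>y. blinfun_apply (T_op F (H s) (?z y))"
  note T = T_lim_tendsto[OF lim] and That = T_lim_tendsto[OF lim']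
  have Tf: "((\<lambda>y. ?T y f) \<longlongrightarrow> W f) (at_right 0)"
    unfolding W_def by (intro tendsto_intros T)
  have "isCont J (W f)"
    using continuous_on_eq_continuous_at[OF open_UNIV, THEN iffD1, OF J_continuous] by (rule bspec) simp
  then have JT: "((\<lambda>y. f - t *\<^sub>C J (?T y f)) \<longlongrightarrow> f - t *\<^sub>C J (W f)) (at_right 0)"
    by (intro tendsto_intros bounded_linear.tendsto[OF bounded_linear_scaleC_right]
        isCont_tendsto_compose[of _ J] Tf)
  have z: "((\<lambda>y. complex_of_real lam - ?z y) \<longlongrightarrow> complex_of_real lam - ?z 0) (at_right 0)"
    by (intro tendsto_intros)
  have L: "((\<lambda>y. (fst (?T y f), (complex_of_real lam - ?z y) * snd (?T y f))) \<longlongrightarrow>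
      (fst (W f), (complex_of_real lam - ?z 0) * snd (W f))) (at_right 0)"
    by (intro tendsto_intros Tf z)
  have R: "((\<lambda>y. (blinfun_apply (T_op Fhat Hhat (?z y)) (fst (f - t *\<^sub>C J (?T y f))),
        snd (f - t *\<^sub>C J (?T y f)))) \<longlongrightarrow>
      (blinfun_apply (T_lim Fhat Hhat lam) (fst (f - t *\<^sub>C J (W f))),
        snd (f - t *\<^sub>C J (W f)))) (at_right 0)"
    by (intro tendsto_intros JT That)
  have LR: "\<forall>\<^sub>F y in at_right 0.
      (fst (?T y f), (complex_of_real lam - ?z y) * snd (?T y f)) =
      (blinfun_apply (T_op Fhat Hhat (?z y)) (fst (f - t *\<^sub>C J (?T y f))),
        snd (f - t *\<^sub>C J (?T y f)))"
    using eventually_at_right_less[of "0::real"]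
    by eventually_elim (simp only: t_def, rule resolvent_identity_left, simp)
  have "(fst (W f), (complex_of_real lam - ?z 0) * snd (W f)) =
      (blinfun_apply (T_lim Fhat Hhat lam) (fst (f - t *\<^sub>C J (W f))), snd (f - t *\<^sub>C J (W f)))"
    by (rule tendsto_unique[OF trivial_limit_at_right_real Lim_transform_eventually[OF L LR] R])
  moreover have "complex_of_real lam - ?z 0 = 0"
    by (simp add: complex_eq_iff)
  ultimately show "fst (W f) = blinfun_apply (T_lim Fhat Hhat lam) (fst (f - t *\<^sub>C J (W f)))"
    "snd (f - t *\<^sub>C J (W f)) = 0"
    by simp_all
qed

text \<open>The input component \<open>(lam - z) * c\<close> vanishes in the limit but
  \<open>c\<close> survives in the output. The choice \<open>f = 0\<close>, \<open>c = 1\<close>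
  yields the kernel vector \<open>v0\<close>, and \<open>c = 0\<close> yields
  \<open>B_S\<close>.\<close>

lemma T_lim_right:
  fixes s c
  defines "t \<equiv> complex_of_real (s - r)"
  assumes lim: "norm_limit_exists F (H s) lam" and lim': "norm_limit_exists Fhat Hhat lam"
  defines "q \<equiv> \<lambda>f. (blinfun_apply (T_lim Fhat Hhat lam) f, c)"
  shows "blinfun_apply (T_lim F (H s) lam) ((f, 0) + t *\<^sub>C J (q f)) = q f"
proof -
  let ?z = "\<lambda>y. Complex lam y"
  let ?q = "\<lambda>y. (blinfun_apply (T_op Fhat Hhat (?z y)) f, c)"
  note T = T_lim_tendsto[OF lim] and That = T_lim_tendsto[OF lim']
  have q: "(?q \<longlongrightarrow> q f) (at_right 0)"
    unfolding q_def by (intro tendsto_intros That)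
  have "isCont J (q f)"
    using continuous_on_eq_continuous_at[OF open_UNIV, THEN iffD1, OF J_continuous] by (rule bspec) simp
  then have Jq: "((\<lambda>y. t *\<^sub>C J (?q y)) \<longlongrightarrow> t *\<^sub>C J (q f)) (at_right 0)"
    by (intro bounded_linear.tendsto[OF bounded_linear_scaleC_right]
        isCont_tendsto_compose[of _ J] q)
  have z: "((\<lambda>y. complex_of_real lam - ?z y) \<longlongrightarrow> complex_of_real lam - ?z 0) (at_right 0)"
    by (intro tendsto_intros)
  have L: "((\<lambda>y. blinfun_apply (T_op F (H s) (?z y))
        ((f, (complex_of_real lam - ?z y) * c) + t *\<^sub>C J (?q y))) \<longlongrightarrow>
      blinfun_apply (T_lim F (H s) lam)
        ((f, (complex_of_real lam - ?z 0) * c) + t *\<^sub>C J (q f))) (at_right 0)"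
    by (intro tendsto_intros T Jq z)
  have LR: "\<forall>\<^sub>F y in at_right 0. blinfun_apply (T_op F (H s) (?z y))
        ((f, (complex_of_real lam - ?z y) * c) + t *\<^sub>C J (?q y)) = ?q y"
    using eventually_at_right_less[of "0::real"]
    by eventually_elim (simp only: t_def, rule resolvent_identity_right, simp)
  have "blinfun_apply (T_lim F (H s) lam)
      ((f, (complex_of_real lam - ?z 0) * c) + t *\<^sub>C J (q f)) = q f"
    by (rule tendsto_unique[OF trivial_limit_at_right_real Lim_transform_eventually[OF L LR] q])
  moreover have "complex_of_real lam - ?z 0 = 0"
    by (simp add: complex_eq_iff)
  ultimately show ?thesis
    by simp
qed

end

section \<open>The block perturbation and the ladder of the resonance point\<close>

lemma continuous_on_block_J: "continuous_on UNIV (block_J Jhat \<psi> \<alpha>)"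
  unfolding block_J_def
  by (intro continuous_intros bounded_linear.continuous_on[OF bounded_linear_scaleC_left])

lemma linear_op_block_J:
  assumes "selfadjoint (Some \<circ> blinfun_apply Jhat)"
  shows "linear_op (Some \<circ> block_J Jhat \<psi> \<alpha>)"
proof -
  have "linear_op (Some \<circ> blinfun_apply Jhat)"
    using assms by (simp add: selfadjoint_def)
  then have scale: "blinfun_apply Jhat (c *\<^sub>C x) = c *\<^sub>C blinfun_apply Jhat x" for c x
    by (simp add: linear_op_iff)
  show ?thesis
    by (simp add: linear_op_iff block_J_def scale zero_prod_def scaleC_prod_def scaleC_complex_def
        blinfun.add_right scaleC_add_left scaleC_add_right scaleC_scaleC cinner_add_right
        cinner_scaleC_right algebra_simps)
qed

theorem theorem1p43:
  fixes Fhat :: "'h::chilbert \<rightharpoonup> 'k::chilbert"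
    and Hhat :: "'h \<rightharpoonup> 'h"
    and Jhat :: "'k \<Rightarrow>\<^sub>L 'k"
    and \<psi> uhat :: 'k
    and Ahat :: "'k \<Rightarrow> 'k"
    and lam r \<alpha> :: real
    and F :: "'h \<times> complex \<rightharpoonup> 'k \<times> complex"
    and Hr V :: "'h \<times> complex \<rightharpoonup> 'h \<times> complex"
    and J :: "'k \<times> complex \<Rightarrow> 'k \<times> complex"
    and H :: "real \<Rightarrow> 'h \<times> complex \<rightharpoonup> 'h \<times> complex"
    and D :: "('h \<times> complex) set"
    and d :: nat
  assumes separable_h: "separable_space (euclidean :: 'h topology)"
    and separable_k: "separable_space (euclidean :: 'k topology)"
    and Fhat: "linear_op Fhat" "closed_op Fhat" "densely_defined Fhat"
      "op_ker Fhat = {0}" "op_ker (adj Fhat) = {0}"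
    and Hhat: "selfadjoint Hhat"
    and Jhat: "selfadjoint (Some \<circ> blinfun_apply Jhat)"
    and F_eq: "F = op_direct_sum Fhat Some"
    and Hr_eq: "Hr = op_direct_sum Hhat (Some \<circ> (\<lambda>c. complex_of_real lam * c))"
    and J_eq: "J = block_J Jhat \<psi> \<alpha>"
    and V_eq: "V = adj F \<circ>\<^sub>m (Some \<circ> J) \<circ>\<^sub>m F"
    and H_eq: "\<And>s. H s = op_add Hr (op_scale (complex_of_real (s - r)) V)"
    and simple_eigenvalue: "complex_vector.dim (eigenspace Hr (complex_of_real lam)) = 1"
    and V_selfadjoint: "selfadjoint V"
    and H_selfadjoint: "\<And>s. selfadjoint (H s)"
    and H_domain: "\<And>s. dom (H s) = D" "closure D = UNIV" "D \<subseteq> dom F \<inter> dom V"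
    and V_rel_compact: "\<And>s. relatively_compact V (H s)"
    and T_compact: "\<And>s z. Im z \<noteq> 0 \<Longrightarrow> extends_to_compact (sandwiched_resolvent F (H s) z)"
    and That_compact: "\<And>z. Im z \<noteq> 0 \<Longrightarrow> extends_to_compact (sandwiched_resolvent Fhat Hhat z)"
    and limiting_absorption: "\<And>s. AE \<mu> in lebesgue. norm_limit_exists F (H s) \<mu>"
    and lam_regular: "norm_limit_exists Fhat Hhat lam"
    and V_regularizing: "\<exists>s. norm_limit_exists F (H s) lam"
    and uhat_eq: "uhat = blinfun_apply (T_lim Fhat Hhat lam) \<psi>"
    and Ahat_eq: "Ahat = (\<lambda>x. blinfun_apply (T_lim Fhat Hhat lam) (blinfun_apply Jhat x))"
    and d_ge_2: "2 \<le> d"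
  shows "\<forall>s. norm_limit_exists F (H s) lam \<longrightarrow>
    (resonance_point_has_order F J H lam r s d \<longleftrightarrow>
       \<alpha> = 0 \<and>
       (\<forall>i<d - 2. cinner \<psi> ((Ahat ^^ i) uhat) = 0) \<and>
       cinner \<psi> ((Ahat ^^ (d - 2)) uhat) \<noteq> 0) \<and>
    (resonance_point_has_order F J H lam r s d \<longrightarrow>
       (\<forall>j\<in>{1..d}.
          complex_vector.dim (Upsilon F J H lam r s j) = j \<and>
          complex_vector.span (insert (0, 1) ((\<lambda>i. ((Ahat ^^ i) uhat, 0)) ` {..<j - 1}))
            = Upsilon F J H lam r s j \<and>
          vector_has_order F J H lam r s (0, 1) 1 \<and>
          (\<forall>i<j - 1. vector_has_order F J H lam r s ((Ahat ^^ i) uhat, 0) (i + 2))))"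
proof (intro allI impI)
  fix s
  assume lim: "norm_limit_exists F (H s) lam"
  define That where "That = blinfun_apply (T_lim Fhat Hhat lam)"
  define W where "W = blinfun_apply (T_lim F (H s) lam)"
  define t where "t = complex_of_real (s - r)"
  define B where "B = (\<lambda>v. v + (r - s) *\<^sub>R W (J v))"
  define S where "S = (\<lambda>x. (That (fst (J x)), 0 :: complex))"
  define l where "l = (\<lambda>x. snd (J x))"

  interpret line: eigenvalue_line Fhat Hhat J lam r F Hr V H
    by unfold_locales (use Fhat Hhat F_eq Hr_eq V_eq H_eq H_selfadjoint T_compact That_compact
      continuous_on_block_J[of Jhat \<psi> \<alpha>] in \<open>simp_all add: J_eq\<close>)
  note left = line.T_lim_left[OF lim lam_regular, folded W_def That_def t_def]
  note right = line.T_lim_right[OF lim lam_regular, folded W_def That_def t_def]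
  have W_scale: "W (c *\<^sub>C f) = c *\<^sub>C W f" for c f
    unfolding W_def
    by (rule T_lim_scaleC[OF lim line.linear_op_F line.densely_defined_F H_selfadjoint T_compact])
  have That_scale: "That (c *\<^sub>C f) = c *\<^sub>C That f" for c f
    unfolding That_def
    by (rule T_lim_scaleC[OF lam_regular Fhat(1,3) Hhat That_compact])
  have W_add: "W (f + g) = W f + W g" and That_add: "That (f' + g') = That f' + That g'"
    and W_0: "W 0 = 0" and That_0: "That 0 = 0" for f g f' g'
    by (simp_all add: W_def That_def blinfun.add_right)
  have J_scale: "J (c *\<^sub>C x) = c *\<^sub>C J x" and J_add: "J (x + y) = J x + J y" for c x y
    using linear_op_block_J[OF Jhat, of \<psi> \<alpha>] by (simp_all add: linear_op_iff J_eq del: split_paired_All)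
  have B_eq: "B v = v - t *\<^sub>C W (J v)" for v
    by (simp add: B_def t_def scaleR_scaleC flip: complex_vector.scale_minus_left)
  have linear_scaleC: "Vector_Spaces.linear scaleC scaleC A"
    if "\<And>x y. A (x + y) = A x + A y" "\<And>c x. A (c *\<^sub>C x) = c *\<^sub>C A x"
    for A :: "'k \<times> complex \<Rightarrow> 'k \<times> complex"
    using that by unfold_locales simp_all
  have v0: "W (t *\<^sub>C J (0, 1)) = (0, 1)"
    using right[of 0 1] by (simp add: That_0 flip: zero_prod_def)

  interpret ladder scaleC B S l "(0, 1)" t
  proof (rule ladder.intro[OF complex_vector.vector_space_axioms ladder_axioms.intro])
    show "Vector_Spaces.linear scaleC scaleC B"
      by (rule linear_scaleC)
        (simp_all add: B_eq J_add J_scale W_add W_scale scaleC_add_right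
          complex_vector.scale_right_diff_distrib mult.commute)
    show "Vector_Spaces.linear scaleC scaleC S"
      by (rule linear_scaleC)
        (simp_all add: S_def J_add J_scale That_add That_scale fst_scaleC snd_scaleC prod_eq_iff)
    show "Vector_Spaces.linear scaleC (*) l"
      by unfold_locales
        (simp_all add: l_def J_add J_scale snd_scaleC algebra_simps)
    \<comment> \<open>Equivalently, \<open>s\<close> differs from \<open>r\<close>: a limit at
      \<open>r\<close> itself would send 0 to \<open>(0, 1)\<close>, so \<open>r\<close> is
      resonant.\<close>
    show "t \<noteq> 0"
    proof
      assume "t = 0"
      then have "W (t *\<^sub>C J (0, 1)) = 0"
        by (simp add: W_0)
      with v0 show False
        by (simp add: zero_prod_def)
    qed
    show "(0, 1) \<noteq> (0 :: 'k \<times> complex)"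
      by (simp add: zero_prod_def)
    show "B (0, 1) = 0"
      using v0 by (simp add: B_eq W_scale)
    \<comment> \<open>\<open>J B = (1 - t J W) J\<close>, so the left identities at
      \<open>J w\<close> speak about \<open>J (B w)\<close>.\<close>
    have J_B: "J (B w) = J w - t *\<^sub>C J (W (J w))" for w
      using J_add[of "B w" "t *\<^sub>C W (J w)"] by (simp add: B_eq J_scale eq_diff_eq)
    show "l (B w) = 0" for w
      using left(2)[of "J w"] by (simp add: l_def J_B)
    show "w - B w - t *\<^sub>C S (B w) \<in> complex_vector.span {(0, 1)}" for w
    proof -
      have "fst (w - B w - t *\<^sub>C S (B w)) = 0"
        using left(1)[of "J w"] by (simp add: B_eq[of w] S_def fst_scaleC flip: J_B)
      then have "w - B w - t *\<^sub>C S (B w) = snd (w - B w - t *\<^sub>C S (B w)) *\<^sub>C (0, 1)"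
        by (simp add: prod_eq_iff fst_scaleC snd_scaleC)
      then show ?thesis
        by (metis complex_vector.span_base complex_vector.span_scale singletonI)
    qed
    show "t *\<^sub>C B (S x) = x - B x" if "l x = 0" for x
    proof -
      have "J x = (fst (J x), 0)"
        using that by (simp add: l_def prod_eq_iff)
      then have "W (J x + t *\<^sub>C J (S x)) = S x"
        using right[of "fst (J x)" 0] by (simp add: S_def)
      then have "B (S x) = W (J x)"
        by (simp add: B_eq W_add W_scale diff_eq_eq)
      then show ?thesis
        by (simp add: B_eq)
    qed
  qed

  have Upsilon: "Upsilon F J H lam r s = Y"
    unfolding fun_eq_iff Upsilon_def Y_def by (simp add: B_def W_def)
  \<comment> \<open>Since \<open>J (0, 1) = (\<psi>, \<alpha>)\<close>, the first step of the ladder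
    produces \<open>uhat\<close>; afterwards the second component is 0 and \<open>S\<close> acts as
    \<open>Ahat\<close>.\<close>
  have S_values: "S (0, 1) = (uhat, 0)" "S (x, 0) = (Ahat x, 0)" for x
    by (simp_all add: S_def J_eq block_J_def uhat_eq Ahat_eq That_def scaleC_one)
  have l_values: "l (0, 1) = complex_of_real \<alpha>" "l (x, 0) = cinner \<psi> x" for x
    by (simp_all add: l_def J_eq block_J_def)
  have rung: "rung (Suc i) = ((Ahat ^^ i) uhat, 0)" for i
    by (induction i) (simp_all only: rung_Suc rung_0 S_values funpow.simps o_apply id_apply)
  have l_rung: "l (rung 0) = complex_of_real \<alpha>" "l (rung (Suc i)) = cinner \<psi> ((Ahat ^^ i) uhat)" for i
    by (simp_all only: rung rung_0 l_values)
  obtain m where d: "d = Suc (Suc m)"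
    using d_ge_2 by (metis Suc_le_D numeral_2_eq_2 Suc_le_mono)
  have order_iff: "resonance_point_has_order F J H lam r s d \<longleftrightarrow>
      (\<forall>i<Suc m. l (rung i) = 0) \<and> l (rung (Suc m)) \<noteq> 0"
    unfolding stable_iff[symmetric]
    by (simp add: resonance_point_has_order_def Upsilon d less_Suc_eq_le)
  have "resonance_point_has_order F J H lam r s d \<longleftrightarrow>
      \<alpha> = 0 \<and> (\<forall>i<d - 2. cinner \<psi> ((Ahat ^^ i) uhat) = 0) \<and>
      cinner \<psi> ((Ahat ^^ (d - 2)) uhat) \<noteq> 0"
    \<comment> \<open>Index 0 is split off: it gives \<alpha> = 0, and the remaining rungs give the
      orthogonality conditions with the index lowered by one.\<close>
    unfolding order_iff All_less_Suc2 l_rung by (simp add: d)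
  moreover have "complex_vector.dim (Upsilon F J H lam r s j) = j \<and>
      complex_vector.span (insert (0, 1) ((\<lambda>i. ((Ahat ^^ i) uhat, 0)) ` {..<j - 1}))
        = Upsilon F J H lam r s j \<and>
      vector_has_order F J H lam r s (0, 1) 1 \<and>
      (\<forall>i<j - 1. vector_has_order F J H lam r s ((Ahat ^^ i) uhat, 0) (i + 2))"
    if order: "resonance_point_has_order F J H lam r s d" and j: "j \<in> {1..d}" for j
  proof -
    have zero: "l (rung i) = 0" if "Suc i < d" for i
      using order that unfolding order_iff by (simp add: d)
    have vector: "vector_has_order F J H lam r s (rung i) (Suc i)" if "i < d" for i
      using rung_order[of i] zero that by (simp add: vector_has_order_def Upsilon)
    obtain n where n: "j = Suc n" "n < d"
      using j by (cases j) auto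
    have "complex_vector.dim (Y j) = j" "Y j = complex_vector.span (rung ` {..<j})"
      by (rule dim_Y, use zero n in simp, rule Y_eq_span, use zero n in simp)
    moreover have "rung ` {..<j} = insert (0, 1) ((\<lambda>i. ((Ahat ^^ i) uhat, 0)) ` {..<j - 1})"
      by (simp add: n lessThan_Suc_eq_insert_0 image_image rung rung_0)
    moreover have "vector_has_order F J H lam r s (0, 1) 1"
      using vector[of 0] by (simp add: d rung_0)
    moreover have "vector_has_order F J H lam r s ((Ahat ^^ i) uhat, 0) (i + 2)" if "i < j - 1" for i
      using vector[of "Suc i"] that n by (simp add: rung)
    ultimately show ?thesis
      by (simp add: Upsilon)
  qed
  ultimately show "(resonance_point_has_order F J H lam r s d \<longleftrightarrow>
       \<alpha> = 0 \<and>
       (\<forall>i<d - 2. cinner \<psi> ((Ahat ^^ i) uhat) = 0) \<and>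
       cinner \<psi> ((Ahat ^^ (d - 2)) uhat) \<noteq> 0) \<and>
    (resonance_point_has_order F J H lam r s d \<longrightarrow>
       (\<forall>j\<in>{1..d}.
          complex_vector.dim (Upsilon F J H lam r s j) = j \<and>
          complex_vector.span (insert (0, 1) ((\<lambda>i. ((Ahat ^^ i) uhat, 0)) ` {..<j - 1}))
            = Upsilon F J H lam r s j \<and>
          vector_has_order F J H lam r s (0, 1) 1 \<and>
          (\<forall>i<j - 1. vector_has_order F J H lam r s ((Ahat ^^ i) uhat, 0) (i + 2))))"
    by blast
qed

end
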